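(* There is a constant $c>0$ such that for every positive integer $n$ and every $f:\{\pm1\}^n\to[-1,1]$, $$\log\left(\|\hat f\|_0\right)\ge c\sum_{j=1}^n|\hat f(\{j\})|.$$
   Context: For $S\subseteq[n]=\{1,\dots,n\}$, let $\chi_S(x)=\prod_{j\in S}x_j$ for $x\in\{\pm1\}^n$. Every $f:\{\pm1\}^n\to\mathbb{R}$ can be uniquely written as $f(x)=\sum_{S\subseteq[n]}\hat f(S)\chi_S(x)$ with Fourier coefficients $\hat f(S)\in\mathbb{R}$. The sparsity $\|\hat f\|_0$ of $\hat f$ is the number of sets $S\subseteq[n]$ such that $\hat f(S)\ne 0$.
   Formalization: Functions of the form f(x) = a·x_j (a real, possibly 0) are excluded: for a ≠ 0 the sparsity is 1, so its logarithm is 0 while the sum is |a| > 0, and for f = 0 the logarithm of the sparsity is undefined. *)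

theory Defs
  imports Complex_Main "HOL-Library.FuncSet"
begin

text \<open>
  Points of the cube are functions on the naturals; outside \<open>{1..n}\<close> they
  take the fixed value \<open>undefined\<close>, so that there are exactly \<open>2 ^ n\<close> of them.
\<close>

definition cube :: "nat \<Rightarrow> (nat \<Rightarrow> real) set" where
  "cube n = {1..n} \<rightarrow>\<^sub>E {-1, 1}"

definition chi :: "nat set \<Rightarrow> (nat \<Rightarrow> real) \<Rightarrow> real" where
  "chi S x = (\<Prod>j\<in>S. x j)"

text \<open>
  The coefficient family is indexed by all sets of naturals and is normalised to
  \<open>0\<close> off the subsets of \<open>{1..n}\<close>, which makes it unique as a function.
\<close>

definition is_fourier_expansion ::
    "nat \<Rightarrow> ((nat \<Rightarrow> real) \<Rightarrow> real) \<Rightarrow> (nat set \<Rightarrow> real) \<Rightarrow> bool" where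
  "is_fourier_expansion n f a \<longleftrightarrow>
     (\<forall>x\<in>cube n. f x = (\<Sum>S\<in>Pow {1..n}. a S * chi S x)) \<and>
     (\<forall>S. \<not> S \<subseteq> {1..n} \<longrightarrow> a S = 0)"

definition fourier_coeff :: "nat \<Rightarrow> ((nat \<Rightarrow> real) \<Rightarrow> real) \<Rightarrow> nat set \<Rightarrow> real" where
  "fourier_coeff n f = (THE a. is_fourier_expansion n f a)"

definition sparsity :: "nat \<Rightarrow> ((nat \<Rightarrow> real) \<Rightarrow> real) \<Rightarrow> nat" where
  "sparsity n f = card {S. S \<subseteq> {1..n} \<and> fourier_coeff n f S \<noteq> 0}"

lemma finite_cube: "finite (cube n)"
  by (auto simp: cube_def intro!: finite_PiE)

lemma sum_chi_chi:
  assumes "S \<subseteq> {1..n}" "T \<subseteq> {1..n}"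
  shows "(\<Sum>x\<in>cube n. chi S x * chi T x) = (if S = T then 2 ^ n else 0)"
proof -
  define g :: "nat \<Rightarrow> real \<Rightarrow> real" where
    "g j v = (if j \<in> S then v else 1) * (if j \<in> T then v else 1)" for j v
  have chi_eq: "chi U x = (\<Prod>j\<in>{1..n}. if j \<in> U then x j else 1)"
    if "U \<subseteq> {1..n}" for U x
  proof -
    have "{1..n} \<inter> U = U" using that by auto
    then show ?thesis
      unfolding chi_def by (simp flip: prod.inter_restrict)
  qed
  have "(\<Sum>x\<in>cube n. chi S x * chi T x) = (\<Sum>x\<in>cube n. \<Prod>j\<in>{1..n}. g j (x j))"
    unfolding chi_eq[OF assms(1)] chi_eq[OF assms(2)] g_def prod.distrib ..
  also have "\<dots> = (\<Prod>j\<in>{1..n}. \<Sum>v\<in>{-1, 1}. g j v)"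
    unfolding cube_def by (subst prod_sum_PiE) auto
  also have "\<dots> = (\<Prod>j\<in>{1..n}. if j \<in> S \<longleftrightarrow> j \<in> T then 2 else 0)"
    by (intro prod.cong) (auto simp: g_def)
  also have "\<dots> = (if S = T then 2 ^ n else 0)"
  proof (cases "S = T")
    case False
    then have "\<exists>j\<in>{1..n}. \<not> (j \<in> S \<longleftrightarrow> j \<in> T)" using assms by blast
    then show ?thesis using False by (auto simp: prod_zero_iff)
  qed simp
  finally show ?thesis .
qed

lemma sum_chi_point:
  assumes "x \<in> cube n" "y \<in> cube n"
  shows "(\<Sum>S\<in>Pow {1..n}. chi S x * chi S y) = (if x = y then 2 ^ n else 0)"
proof -
  have vals: "z j = -1 \<or> z j = 1" if "z \<in> cube n" "j \<in> {1..n}" for z j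
    using that PiE_mem unfolding cube_def by fastforce
  have "(\<Sum>S\<in>Pow {1..n}. chi S x * chi S y) = (\<Prod>j\<in>{1..n}. x j * y j + 1)"
    by (subst prod_add) (simp_all add: chi_def prod.distrib)
  also have "\<dots> = (\<Prod>j\<in>{1..n}. if x j = y j then 2 else 0)"
    using vals[OF assms(1)] vals[OF assms(2)] by (intro prod.cong) force+
  also have "\<dots> = (if x = y then 2 ^ n else 0)"
  proof (cases "x = y")
    case False
    then have "\<exists>j\<in>{1..n}. x j \<noteq> y j" using assms unfolding cube_def by (metis PiE_ext)
    then show ?thesis using False by (auto simp: prod_zero_iff)
  qed simp
  finally show ?thesis .
qed

lemma fourier_expansion_exists:
  "is_fourier_expansion n f
     (\<lambda>S. if S \<subseteq> {1..n} then (\<Sum>x\<in>cube n. f x * chi S x) / 2 ^ n else 0)"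
proof -
  have "f x = (\<Sum>S\<in>Pow {1..n}. (\<Sum>y\<in>cube n. f y * chi S y) / 2 ^ n * chi S x)"
    if x: "x \<in> cube n" for x
  proof -
    have "(\<Sum>S\<in>Pow {1..n}. (\<Sum>y\<in>cube n. f y * chi S y) / 2 ^ n * chi S x)
        = (\<Sum>S\<in>Pow {1..n}. \<Sum>y\<in>cube n. f y / 2 ^ n * (chi S y * chi S x))"
      by (simp add: sum_divide_distrib sum_distrib_right mult.assoc)
    also have "\<dots> = (\<Sum>y\<in>cube n. f y / 2 ^ n * (\<Sum>S\<in>Pow {1..n}. chi S y * chi S x))"
      by (subst sum.swap) (simp add: sum_distrib_left)
    also have "\<dots> = (\<Sum>y\<in>cube n. if y = x then f y else 0)"
      by (intro sum.cong refl) (simp add: sum_chi_point[OF _ x] del: One_nat_def)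
    also have "\<dots> = f x"
      using x finite_cube by simp
    finally show ?thesis by simp
  qed
  then show ?thesis
    by (auto simp: is_fourier_expansion_def intro!: sum.cong)
qed

lemma fourier_expansion_coeff:
  assumes "is_fourier_expansion n f a" "T \<subseteq> {1..n}"
  shows "a T = (\<Sum>x\<in>cube n. f x * chi T x) / 2 ^ n"
proof -
  have "(\<Sum>x\<in>cube n. f x * chi T x)
      = (\<Sum>x\<in>cube n. \<Sum>S\<in>Pow {1..n}. a S * (chi S x * chi T x))"
    using assms(1)
    by (intro sum.cong) (auto simp: is_fourier_expansion_def sum_distrib_right mult.assoc)
  also have "\<dots> = (\<Sum>S\<in>Pow {1..n}. a S * (\<Sum>x\<in>cube n. chi S x * chi T x))"
    by (subst sum.swap) (simp add: sum_distrib_left)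
  also have "\<dots> = (\<Sum>S\<in>Pow {1..n}. if S = T then a S * 2 ^ n else 0)"
    using assms(2) by (intro sum.cong refl) (auto simp: sum_chi_chi)
  also have "\<dots> = a T * 2 ^ n"
    using assms(2) by simp
  finally show ?thesis by simp
qed

lemma fourier_expansion_unique: "\<exists>!a. is_fourier_expansion n f a"
proof (rule ex_ex1I)
  show "\<exists>a. is_fourier_expansion n f a"
    using fourier_expansion_exists by blast
next
  fix a b
  assume ab: "is_fourier_expansion n f a" "is_fourier_expansion n f b"
  show "a = b"
  proof
    fix T
    show "a T = b T"
    proof (cases "T \<subseteq> {1..n}")
      case True
      then show ?thesis using ab fourier_expansion_coeff by metis
    next
      case False
      then show ?thesis using ab unfolding is_fourier_expansion_def by metis
    qed
  qed
qed

lemma fourier_coeff_expansion: "is_fourier_expansion n f (fourier_coeff n f)"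
  unfolding fourier_coeff_def by (rule theI'[OF fourier_expansion_unique])

lemma fourier_coeff_eq:
  "T \<subseteq> {1..n} \<Longrightarrow> fourier_coeff n f T = (\<Sum>x\<in>cube n. f x * chi T x) / 2 ^ n"
  by (rule fourier_expansion_coeff[OF fourier_coeff_expansion])

text \<open>
  If \<open>f = a \<cdot> x\<^sub>j\<close> with \<open>a \<noteq> 0\<close>, the sparsity is \<open>1\<close> and its logarithm \<open>0\<close>, while
  the sum of the absolute degree-one coefficients is \<open>\<bar>a\<bar> > 0\<close>; if \<open>f = 0\<close>, the sparsity
  is \<open>0\<close> and has no logarithm. For these \<open>f\<close>, and only these, the literal
  inequality between the logarithm of the sparsity and the degree-one sum fails
  for every positive constant or is meaningless.
\<close>

definition coordinate_multiple :: "nat \<Rightarrow> ((nat \<Rightarrow> real) \<Rightarrow> real) \<Rightarrow> bool" where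
  "coordinate_multiple n f \<longleftrightarrow> (\<exists>j\<in>{1..n}. \<exists>a. \<forall>x\<in>cube n. f x = a * x j)"

end

(*
  Fix signs sigma_j making sigma_j * fhat({j}) nonnegative. The product measure with means
  z_j = sigma_j * t / 2 averages f to g(t) = sum_S fhat(S) * chi_S(sigma) * (t/2)^|S|, so
  |g| <= 1 on [-1,1], while g'(0) is half the degree-one sum. If the sparsity is at most 2^d,
  the terms of g of degree > d are exponentially damped, so a Bernstein-type bound for polynomials
  of degree d gives g'(0) = O(d). It is obtained from a signed measure on [-1,1] of total
  variation at most 2d that represents p |-> p'(0) on polynomials p of degree at most d: substitute
  t = sin(theta) and use the kernel 2d * sin(d theta) * F_d(theta), F_d the Fejer kernel,
  whose k-th frequency is i*k for |k| <= d; it is discretised at 3d equispaced nodes.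
*)
theory Submission
  imports Defs "HOL-Analysis.Complex_Transcendental"
begin

section \<open>Discrete orthogonality and the Fejer kernel at equispaced nodes\<close>

text \<open>A geometric sum whose ratio is an \<open>N\<close>-th root of unity. The bound on
  \<open>r\<close> rules out aliasing: 0 is the only multiple of \<open>N\<close> in range, so for
  every other \<open>r\<close> the ratio differs from 1.\<close>

lemma sum_cis_equispaced:
  fixes r :: int
  assumes "\<bar>r\<bar> < int N"
  shows "(\<Sum>i<N. cis (real_of_int r * (2 * pi * real i / real N))) = (if r = 0 then of_nat N else 0)"
proof (cases "r = 0")
  case False
  define q where "q = cis (2 * pi * real_of_int r / real N)"
  have N: "real N > 0" using assms by simp
  have "q \<noteq> 1"
  proof
    assume "q = 1"
    then have "cos (2 * pi * real_of_int r / real N) = 1"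
      by (simp add: q_def complex_eq_iff)
    then obtain k :: int where "2 * pi * real_of_int r / real N = real_of_int k * 2 * pi"
      using cos_one_2pi_int by blast
    then have "real_of_int r = real_of_int k * real N"
      using N by (simp add: field_simps)
    then have "r = k * int N" by (metis of_int_eq_iff of_int_mult of_int_of_nat_eq)
    with False assms show False by (simp add: abs_mult)
  qed
  moreover have "q ^ N = 1"
    using N by (simp add: q_def Complex.DeMoivre complex_eq_iff)
  moreover have "(\<Sum>i<N. cis (real_of_int r * (2 * pi * real i / real N))) = (\<Sum>i<N. q ^ i)"
    by (intro sum.cong) (simp_all add: q_def Complex.DeMoivre mult_ac)
  ultimately show ?thesis
    using False by (simp add: geometric_sum)
qed simp

text \<open>These are the triangular Fejer coefficients: the solutions lie on the line
  \<open>b = a + c\<close>, and \<open>nat\<close> truncates the count to 0 once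
  \<open>\<bar>c\<bar>\<close> reaches \<open>d\<close>.\<close>

lemma card_pairs_diff:
  fixes c :: int
  shows "card {(a, b) \<in> {..<d} \<times> {..<d}. c + int a - int b = 0} = nat (int d - \<bar>c\<bar>)"
proof -
  have "{(a, b) \<in> {..<d} \<times> {..<d}. c + int a - int b = 0}
      = (\<lambda>k. (k + nat (- c), k + nat c)) ` {..<nat (int d - \<bar>c\<bar>)}" (is "?L = ?R")
  proof
    show "?L \<subseteq> ?R"
    proof clarify
      fix a b assume "c + int a - int b = 0" "a < d" "b < d"
      then show "(a, b) \<in> ?R"
        by (intro image_eqI[of _ _ "min a b"]) auto
    qed
  qed auto
  then show ?thesis
    by (simp add: card_image inj_on_def)
qed

text \<open>The squared modulus is \<open>d\<close> times the Fejer kernel; it expands over pairs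
  into frequencies \<open>c + a - b\<close>. Their absolute values are at most
  \<open>2 * d + (d - 1)\<close>, so \<open>3 * d\<close> nodes separate them from 0.\<close>

lemma fejer_sum:
  fixes c :: int
  assumes "\<bar>c\<bar> \<le> 2 * int d"
  defines "\<theta> \<equiv> \<lambda>i::nat. 2 * pi * real i / real (3 * d)"
  shows "(\<Sum>i<3*d. cis (real_of_int c * \<theta> i) * of_real ((cmod (\<Sum>k<d. cis (real k * \<theta> i)))\<^sup>2))
    = of_nat (3 * d * nat (int d - \<bar>c\<bar>))"
proof -
  have "cis (real_of_int c * \<theta> i) * of_real ((cmod (\<Sum>k<d. cis (real k * \<theta> i)))\<^sup>2)
      = (\<Sum>(a, b)\<in>{..<d} \<times> {..<d}. cis (real_of_int (c + int a - int b) * \<theta> i))" for i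
    unfolding complex_norm_square cnj_sum sum_product sum.cartesian_product
    unfolding sum_distrib_left
    by (intro sum.cong) (auto simp: cis_cnj cis_mult algebra_simps)
  then have "(\<Sum>i<3*d. cis (real_of_int c * \<theta> i) * of_real ((cmod (\<Sum>k<d. cis (real k * \<theta> i)))\<^sup>2))
      = (\<Sum>(a, b)\<in>{..<d} \<times> {..<d}. \<Sum>i<3*d. cis (real_of_int (c + int a - int b) * \<theta> i))"
    by (simp add: sum.swap[of _ "{..<3*d}"] case_prod_unfold)
  also have "\<dots> = (\<Sum>(a, b)\<in>{..<d} \<times> {..<d}. if c + int a - int b = 0 then of_nat (3 * d) else 0)"
    unfolding \<theta>_def using assms(1) by (intro sum.cong refl) (clarify, subst sum_cis_equispaced, auto)
  also have "\<dots> = (\<Sum>p\<in>{(a, b) \<in> {..<d} \<times> {..<d}. c + int a - int b = 0}. of_nat (3 * d))"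
    by (intro sum.mono_neutral_cong_right) (auto split: if_splits)
  also have "\<dots> = of_nat (3 * d * nat (int d - \<bar>c\<bar>))"
    by (simp only: sum_constant card_pairs_diff of_nat_mult mult_ac)
  finally show ?thesis .
qed

section \<open>Sine powers and quadrature for the derivative at 0\<close>

text \<open>The binomial theorem applied to Euler's formula. The second identity is the first one
  differentiated at 0, which avoids evaluating binomial sums; its factors \<open>\<i> * k\<close>
  are what the kernel assigns to frequency \<open>k\<close>.\<close>

lemma sin_power_exp_expansion:
  obtains c :: "nat \<Rightarrow> complex" where
    "\<And>z. sin z ^ m = (\<Sum>j\<le>m. c j * exp (\<i> * of_int (2 * int j - int m) * z))"
    "(\<Sum>j\<le>m. c j * (\<i> * of_int (2 * int j - int m))) = (if m = 1 then 1 else 0)"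
proof
  define c :: "nat \<Rightarrow> complex" where
    "c j = of_nat (m choose j) * (- 1) ^ (m - j) / (2 * \<i>) ^ m" for j
  show expand: "sin z ^ m = (\<Sum>j\<le>m. c j * exp (\<i> * of_int (2 * int j - int m) * z))" for z
  proof -
    have "exp (\<i> * z) ^ j * exp (- (\<i> * z)) ^ (m - j) = exp (\<i> * of_int (2 * int j - int m) * z)"
      if "j \<le> m" for j
      using that by (simp add: exp_of_nat_mult[symmetric] exp_add[symmetric] of_nat_diff algebra_simps)
    note e = this
    have "sin z ^ m = (exp (\<i> * z) + - exp (- (\<i> * z))) ^ m / (2 * \<i>) ^ m"
      by (simp only: sin_exp_eq power_divide diff_conv_add_uminus)
    also have "\<dots> = (\<Sum>j\<le>m. c j * (exp (\<i> * z) ^ j * exp (- (\<i> * z)) ^ (m - j)))"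
      unfolding binomial_ring c_def sum_divide_distrib
      by (intro sum.cong refl) (simp add: power_minus[of "exp (- (\<i> * z))"] mult_ac)
    also have "\<dots> = (\<Sum>j\<le>m. c j * exp (\<i> * of_int (2 * int j - int m) * z))"
      by (intro sum.cong refl) (simp only: e atMost_iff)
    finally show ?thesis .
  qed
  have "((\<lambda>z. \<Sum>j\<le>m. c j * exp (\<i> * of_int (2 * int j - int m) * z)) has_field_derivative
      (\<Sum>j\<le>m. c j * (\<i> * of_int (2 * int j - int m)))) (at 0)"
    by (auto intro!: derivative_eq_intros sum.cong)
  moreover have "((\<lambda>z::complex. sin z ^ m) has_field_derivative (if m = 1 then 1 else 0)) (at 0)"
    by (auto intro!: derivative_eq_intros)
  ultimately show "(\<Sum>j\<le>m. c j * (\<i> * of_int (2 * int j - int m))) = (if m = 1 then 1 else 0)"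
    unfolding expand by (rule DERIV_unique)
qed

lemma quadrature_derivative_at_0:
  fixes d :: nat
  assumes "d > 0"
  obtains N :: nat and w t :: "nat \<Rightarrow> real" where
    "(\<Sum>i<N. \<bar>w i\<bar>) \<le> 2 * real d"
    "\<And>i. \<bar>t i\<bar> \<le> 1"
    "\<And>m. m \<le> d \<Longrightarrow> (\<Sum>i<N. w i * t i ^ m) = (if m = 1 then 1 else 0)"
proof
  define \<theta> where "\<theta> i = 2 * pi * real i / real (3 * d)" for i :: nat
  define F where "F i = (cmod (\<Sum>k<d. cis (real k * \<theta> i)))\<^sup>2" for i
  \<comment> \<open>The equal node weight \<open>1 / (3 * d)\<close> times the kernel;
    \<open>F\<close> already contains the factor \<open>d\<close>.\<close>
  define w where "w i = 2 / real (3 * d) * sin (real d * \<theta> i) * F i" for i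
  have fejer: "(\<Sum>i<3*d. cis (real_of_int c * \<theta> i) * of_real (F i)) = of_nat (3 * d * nat (int d - \<bar>c\<bar>))"
    if "\<bar>c\<bar> \<le> 2 * int d" for c
    using fejer_sum[OF that] by (simp only: \<theta>_def F_def)
  \<comment> \<open>Since \<open>F\<close> is nonnegative and the sine is at most 1 in absolute
    value, the frequency-0 sum of \<open>F\<close> controls the total variation.\<close>
  have "(\<Sum>i<3*d. complex_of_real (F i)) = of_nat (3 * d * d)"
    using fejer[of 0] by simp
  then have "complex_of_real (\<Sum>i<3*d. F i) = complex_of_real (real (3 * d * d))"
    by simp
  then have sumF: "(\<Sum>i<3*d. F i) = real (3 * d * d)"
    by (simp only: of_real_eq_iff)
  have "\<bar>w i\<bar> \<le> 2 / real (3 * d) * F i" for i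
  proof -
    have "\<bar>w i\<bar> = \<bar>sin (real d * \<theta> i)\<bar> * (2 / real (3 * d) * F i)"
      by (simp add: w_def abs_mult F_def)
    also have "\<dots> \<le> 1 * (2 / real (3 * d) * F i)"
      by (intro mult_right_mono) (auto simp: F_def)
    finally show ?thesis by simp
  qed
  then have "(\<Sum>i<3*d. \<bar>w i\<bar>) \<le> 2 / real (3 * d) * (\<Sum>i<3*d. F i)"
    unfolding sum_distrib_left by (rule sum_mono)
  also have "\<dots> = 2 * real d"
    using assms by (simp add: sumF)
  finally show "(\<Sum>i<3*d. \<bar>w i\<bar>) \<le> 2 * real d" .
  \<comment> \<open>The sine shifts frequencies by \<open>d\<close> both ways, so the coefficient is
    a difference of two triangles centred at \<open>- d\<close> and \<open>d\<close>. On
    \<open>[-d, d]\<close> this difference is linear in \<open>k\<close>.\<close>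
  have freq: "(\<Sum>i<3*d. complex_of_real (w i) * cis (real_of_int k * \<theta> i)) = \<i> * of_int k"
    if "\<bar>k\<bar> \<le> int d" for k
  proof -
    have sin_eq: "complex_of_real (sin x) = - \<i> / 2 * (cis x - cis (- x))" for x
      by (simp add: complex_eq_iff)
    have shift: "cis (real_of_int (k + int d) * \<theta> i) = cis (real_of_int k * \<theta> i) * cis (real d * \<theta> i)"
      "cis (real_of_int (k - int d) * \<theta> i) = cis (real_of_int k * \<theta> i) * cis (- (real d * \<theta> i))" for i
      by (simp_all add: cis_mult algebra_simps)
    have "complex_of_real (w i) * cis (real_of_int k * \<theta> i)
        = - \<i> / of_nat (3 * d) * (cis (real_of_int (k + int d) * \<theta> i) * of_real (F i)
           - cis (real_of_int (k - int d) * \<theta> i) * of_real (F i))" for i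
      unfolding w_def of_real_mult sin_eq shift by (simp add: algebra_simps)
    then have "(\<Sum>i<3*d. complex_of_real (w i) * cis (real_of_int k * \<theta> i))
        = - \<i> / of_nat (3 * d) * ((\<Sum>i<3*d. cis (real_of_int (k + int d) * \<theta> i) * of_real (F i))
           - (\<Sum>i<3*d. cis (real_of_int (k - int d) * \<theta> i) * of_real (F i)))"
      by (simp only: sum_subtractf flip: sum_distrib_left)
    also have "\<dots> = - \<i> / of_nat (3 * d) * (of_nat (3 * d * nat (int d - \<bar>k + int d\<bar>))
           - of_nat (3 * d * nat (int d - \<bar>k - int d\<bar>)))"
      using that by (subst (1 2) fejer) auto
    also have "\<dots> = (of_int (int (nat (int d - \<bar>k + int d\<bar>)) - int (nat (int d - \<bar>k - int d\<bar>)))) * - \<i>"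
      using assms by (simp add: field_simps)
    also have "int (nat (int d - \<bar>k + int d\<bar>)) - int (nat (int d - \<bar>k - int d\<bar>)) = - k"
      using that by linarith
    finally show ?thesis by (simp add: field_simps)
  qed
  show "\<bar>sin (\<theta> i)\<bar> \<le> 1" for i by simp
  show "(\<Sum>i<3*d. w i * sin (\<theta> i) ^ m) = (if m = 1 then 1 else 0)" if "m \<le> d" for m
  proof -
    obtain c where
      c: "\<And>z. sin z ^ m = (\<Sum>j\<le>m. c j * exp (\<i> * of_int (2 * int j - int m) * z))"
        "(\<Sum>j\<le>m. c j * (\<i> * of_int (2 * int j - int m))) = (if m = 1 then 1 else 0)"
      by (rule sin_power_exp_expansion[of m]) blast
    have "complex_of_real (w i * sin (\<theta> i) ^ m)
        = (\<Sum>j\<le>m. c j * (complex_of_real (w i) * cis (real_of_int (2 * int j - int m) * \<theta> i)))" for i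
      using c(1)[of "of_real (\<theta> i)"]
      by (simp add: sin_of_real cis_conv_exp sum_distrib_left mult_ac)
    then have "complex_of_real (\<Sum>i<3*d. w i * sin (\<theta> i) ^ m)
        = (\<Sum>j\<le>m. c j * (\<Sum>i<3*d. complex_of_real (w i) * cis (real_of_int (2 * int j - int m) * \<theta> i)))"
      unfolding of_real_sum sum_distrib_left by (subst sum.swap) simp
    \<comment> \<open>The frequencies \<open>2 * j - m\<close> lie in \<open>[-m, m]\<close>, hence
      in the range of \<open>freq\<close> because \<open>m \<le> d\<close>.\<close>
    also have "\<dots> = (\<Sum>j\<le>m. c j * (\<i> * of_int (2 * int j - int m)))"
      using that by (intro sum.cong refl) (subst freq, auto)
    also have "\<dots> = complex_of_real (if m = 1 then 1 else 0)"
      unfolding c(2) by simp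
    finally show ?thesis by (simp only: of_real_eq_iff)
  qed
qed

section \<open>Bounds for coefficients and for the multilinear extension\<close>

lemma cube_coordinate:
  assumes "x \<in> cube n" "j \<in> {1..n}"
  shows "x j = -1 \<or> x j = 1"
  using assms PiE_mem unfolding cube_def by fastforce

lemma abs_fourier_coeff_le_1:
  assumes "f \<in> cube n \<rightarrow> {-1..1}"
  shows "\<bar>fourier_coeff n f S\<bar> \<le> 1"
proof (cases "S \<subseteq> {1..n}")
  case True
  have "\<bar>f x * chi S x\<bar> \<le> 1" if "x \<in> cube n" for x
  proof -
    have "\<bar>chi S x\<bar> = 1"
      unfolding chi_def abs_prod using True cube_coordinate[OF that]
      by (intro prod.neutral) fastforce
    moreover have "\<bar>f x\<bar> \<le> 1" using assms that by (auto simp: Pi_iff abs_le_iff)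
    ultimately show ?thesis by (simp add: abs_mult)
  qed
  then have "(\<Sum>x\<in>cube n. \<bar>f x * chi S x\<bar>) \<le> real (card (cube n)) * 1"
    by (rule sum_bounded_above)
  then have "\<bar>\<Sum>x\<in>cube n. f x * chi S x\<bar> \<le> real (card (cube n))"
    using sum_abs[of "\<lambda>x. f x * chi S x" "cube n"] by linarith
  also have "card (cube n) = 2 ^ n"
    by (simp add: cube_def card_PiE numeral_2_eq_2)
  finally show ?thesis
    using True by (simp add: fourier_coeff_eq)
next
  case False
  then show ?thesis
    using fourier_coeff_expansion[of n f] by (simp add: is_fourier_expansion_def)
qed

lemma multilinear_extension_bound:
  assumes f: "f \<in> cube n \<rightarrow> {-1..1}" and z: "\<And>j. \<bar>z j\<bar> \<le> 1"
  shows "\<bar>\<Sum>S\<in>Pow {1..n}. fourier_coeff n f S * chi S z\<bar> \<le> 1"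
proof -
  \<comment> \<open>The product measure: coordinate \<open>j\<close> takes the value
    \<open>v\<close> with probability \<open>(1 + v * z j) / 2\<close>. Expanding the product gives
    the sum of \<open>chi S x * chi S z\<close> over all \<open>S\<close>, up to
    \<open>2 ^ n\<close>.\<close>
  define \<mu> where "\<mu> x = (\<Prod>j\<in>{1..n}. x j * z j + 1) / 2 ^ n" for x
  have \<mu>_nonneg: "\<mu> x \<ge> 0" if "x \<in> cube n" for x
  proof -
    have "x j * z j + 1 \<ge> 0" if "j \<in> {1..n}" for j
      using cube_coordinate[OF \<open>x \<in> cube n\<close> that] z[of j] by (auto simp: abs_le_iff)
    then show ?thesis unfolding \<mu>_def by (intro divide_nonneg_nonneg prod_nonneg) auto
  qed
  have "(\<Sum>x\<in>cube n. \<Prod>j\<in>{1..n}. x j * z j + 1) = (\<Prod>j\<in>{1..n}. \<Sum>v\<in>{-1, 1}. v * z j + 1)"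
    unfolding cube_def by (subst prod_sum_PiE) auto
  then have \<mu>_sum: "(\<Sum>x\<in>cube n. \<mu> x) = 1"
    by (simp add: \<mu>_def flip: sum_divide_distrib)
  have "(\<Sum>S\<in>Pow {1..n}. fourier_coeff n f S * chi S z)
      = (\<Sum>S\<in>Pow {1..n}. \<Sum>x\<in>cube n. f x / 2 ^ n * (chi S x * chi S z))"
    by (intro sum.cong refl)
      (simp add: fourier_coeff_eq sum_divide_distrib sum_distrib_left sum_distrib_right mult_ac)
  also have "\<dots> = (\<Sum>x\<in>cube n. f x / 2 ^ n * (\<Sum>S\<in>Pow {1..n}. chi S x * chi S z))"
    by (subst sum.swap) (simp add: sum_distrib_left)
  also have "\<dots> = (\<Sum>x\<in>cube n. f x * \<mu> x)"
    by (simp add: \<mu>_def prod_add chi_def prod.distrib)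
  finally have "\<bar>\<Sum>S\<in>Pow {1..n}. fourier_coeff n f S * chi S z\<bar> \<le> (\<Sum>x\<in>cube n. \<bar>f x * \<mu> x\<bar>)"
    by (simp only: sum_abs)
  also have "\<dots> \<le> (\<Sum>x\<in>cube n. \<mu> x)"
  proof (intro sum_mono)
    fix x assume x: "x \<in> cube n"
    then have "\<bar>f x\<bar> \<le> 1" using f by (auto simp: Pi_iff abs_le_iff)
    then show "\<bar>f x * \<mu> x\<bar> \<le> \<mu> x"
      using \<mu>_nonneg[OF x] by (simp add: abs_mult mult_left_le_one_le)
  qed
  finally show ?thesis using \<mu>_sum by simp
qed

section \<open>The degree-one sum against the sparsity\<close>

text \<open>Quadrature applied to \<open>g\<close> has absolute value at most \<open>2 * d\<close>.
  Degrees up to \<open>d\<close> contribute exactly half the degree-one sum, and higher degrees at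
  most \<open>d\<close>, so half the sum is at most \<open>3 * d\<close>.\<close>

lemma degree_one_sum_le:
  assumes f: "f \<in> cube n \<rightarrow> {-1..1}" and d: "d > 0" and s: "sparsity n f \<le> 2 ^ d"
  shows "(\<Sum>j=1..n. \<bar>fourier_coeff n f {j}\<bar>) \<le> 6 * real d"
proof -
  define a where "a = fourier_coeff n f"
  \<comment> \<open>Where the coefficient vanishes this is 0 rather than a sign, so the estimates
    use only \<open>\<bar>\<sigma> j\<bar> \<le> 1\<close>.\<close>
  define \<sigma> where "\<sigma> j = sgn (a {j})" for j
  obtain N :: nat and w t :: "nat \<Rightarrow> real" where
    w: "(\<Sum>i<N. \<bar>w i\<bar>) \<le> 2 * real d" and
    t: "\<And>i. \<bar>t i\<bar> \<le> 1" and
    mom: "\<And>m. m \<le> d \<Longrightarrow> (\<Sum>i<N. w i * t i ^ m) = (if m = 1 then 1 else 0)"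
    by (rule quadrature_derivative_at_0[OF d]) blast
  define L where "L m = (\<Sum>i<N. w i * t i ^ m)" for m
  define g where "g i = (\<Sum>S\<in>Pow {1..n}. a S * chi S (\<lambda>j. \<sigma> j * (t i / 2)))" for i
  have \<sigma>1: "\<bar>\<sigma> j\<bar> \<le> 1" for j by (simp add: \<sigma>_def sgn_if)
  have g1: "\<bar>g i\<bar> \<le> 1" for i
    unfolding g_def a_def
  proof (rule multilinear_extension_bound[OF f])
    fix j
    have "\<bar>\<sigma> j\<bar> * \<bar>t i / 2\<bar> \<le> 1"
      using t[of i] by (intro mult_le_one \<sigma>1) auto
    then show "\<bar>\<sigma> j * (t i / 2)\<bar> \<le> 1"
      by (simp only: abs_mult)
  qed
  \<comment> \<open>Beyond degree \<open>d\<close> the moments are not known exactly; the total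
    variation still bounds them.\<close>
  have L_bound: "\<bar>L m\<bar> \<le> 2 * real d" for m
  proof -
    have "\<bar>L m\<bar> \<le> (\<Sum>i<N. \<bar>w i * t i ^ m\<bar>)"
      unfolding L_def by (rule sum_abs)
    also have "\<dots> \<le> (\<Sum>i<N. \<bar>w i\<bar>)"
      using t by (intro sum_mono) (simp add: abs_mult power_abs power_le_one mult_left_le)
    finally show ?thesis using w by simp
  qed
  define T where "T S = a S * chi S \<sigma> / 2 ^ card S * L (card S)" for S
  have chi_scale: "chi S (\<lambda>j. \<sigma> j * u) = chi S \<sigma> * u ^ card S" for S u
    by (simp add: chi_def prod.distrib)
  have "(\<Sum>i<N. w i * g i) = (\<Sum>S\<in>Pow {1..n}. \<Sum>i<N. w i * (a S * chi S (\<lambda>j. \<sigma> j * (t i / 2))))"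
    unfolding g_def sum_distrib_left by (rule sum.swap)
  also have "\<dots> = sum T (Pow {1..n})"
    unfolding T_def L_def sum_distrib_left
    by (intro sum.cong refl, subst chi_scale) (simp add: power_divide)
  finally have total: "(\<Sum>i<N. w i * g i) = sum T (Pow {1..n})" .
  have "\<bar>\<Sum>i<N. w i * g i\<bar> \<le> (\<Sum>i<N. \<bar>w i * g i\<bar>)"
    by (rule sum_abs)
  also have "\<dots> \<le> (\<Sum>i<N. \<bar>w i\<bar>)"
    using g1 by (intro sum_mono) (simp add: abs_mult mult_left_le)
  finally have upper: "\<bar>sum T (Pow {1..n})\<bar> \<le> 2 * real d"
    using w total by simp
  \<comment> \<open>The high-degree sets that can contribute; restricting to nonzero coefficients
    bounds their number by the sparsity.\<close>
  define H where "H = {S\<in>Pow {1..n}. a S \<noteq> 0 \<and> d < card S}"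
  have finH: "finite H" by (simp add: H_def)
  have singles: "T {j} = \<bar>a {j}\<bar> / 2" for j
    using d mom[of 1] by (simp add: T_def L_def chi_def \<sigma>_def abs_sgn)
  have "sum T (Pow {1..n}) = sum T ((\<lambda>j. {j}) ` {1..n} \<union> H)"
  proof (rule sum.mono_neutral_right)
    show "\<forall>S\<in>Pow {1..n} - ((\<lambda>j. {j}) ` {1..n} \<union> H). T S = 0"
    proof
      fix S assume S: "S \<in> Pow {1..n} - ((\<lambda>j. {j}) ` {1..n} \<union> H)"
      have "card S \<noteq> 1"
        using S by (auto simp: card_1_singleton_iff)
      then show "T S = 0"
        using S mom[of "card S"] by (cases "d < card S") (auto simp: T_def L_def H_def)
    qed
  qed (auto simp: H_def)
  \<comment> \<open>Disjointness rests on \<open>d > 0\<close>: members of \<open>H\<close> have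
    more than one element.\<close>
  also have "\<dots> = sum T ((\<lambda>j. {j}) ` {1..n}) + sum T H"
    using d finH by (intro sum.union_disjoint) (auto simp: H_def)
  also have "sum T ((\<lambda>j. {j}) ` {1..n}) = (\<Sum>j=1..n. \<bar>a {j}\<bar>) / 2"
    by (subst sum.reindex) (simp_all add: singles sum_divide_distrib)
  finally have split: "sum T (Pow {1..n}) = (\<Sum>j=1..n. \<bar>a {j}\<bar>) / 2 + sum T H" .
  \<comment> \<open>A degree above \<open>d\<close> is at least \<open>Suc d\<close>. Summed over at
    most \<open>2 ^ d\<close> sets, this leaves \<open>d\<close>, strictly less than the quadrature
    bound \<open>2 * d\<close> would give alone.\<close>
  have "\<bar>T S\<bar> \<le> 2 * real d / 2 ^ Suc d" if "S \<in> H" for S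
  proof -
    have "\<bar>a S\<bar> \<le> 1" unfolding a_def by (rule abs_fourier_coeff_le_1[OF f])
    moreover have "\<bar>chi S \<sigma>\<bar> \<le> 1"
      unfolding chi_def abs_prod using \<sigma>1 by (intro prod_le_1) auto
    ultimately have "\<bar>a S\<bar> * \<bar>chi S \<sigma>\<bar> * \<bar>L (card S)\<bar> \<le> 2 * real d"
      using L_bound[of "card S"] mult_mono[of "\<bar>a S\<bar> * \<bar>chi S \<sigma>\<bar>" 1 "\<bar>L (card S)\<bar>" "2 * real d"]
      by (simp add: mult_le_one)
    moreover have "(2::real) ^ Suc d \<le> 2 ^ card S"
      using that by (intro power_increasing) (auto simp: H_def)
    ultimately have "\<bar>a S\<bar> * \<bar>chi S \<sigma>\<bar> * \<bar>L (card S)\<bar> / 2 ^ card S \<le> 2 * real d / 2 ^ Suc d"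
      by (intro frac_le) auto
    then show ?thesis by (simp add: T_def abs_mult)
  qed
  then have "\<bar>sum T H\<bar> \<le> real (card H) * (2 * real d / 2 ^ Suc d)"
    by (rule order_trans[OF sum_abs sum_bounded_above])
  moreover have "card H \<le> sparsity n f"
    unfolding sparsity_def H_def a_def by (intro card_mono) auto
  then have "real (card H) \<le> 2 ^ d"
    using s of_nat_le_iff[of "card H" "2 ^ d", where 'a = real] by simp
  then have "real (card H) * (2 * real d / 2 ^ Suc d) \<le> 2 ^ d * (2 * real d / 2 ^ Suc d)"
    by (intro mult_right_mono) simp_all
  ultimately have "\<bar>sum T H\<bar> \<le> real d"
    by simp
  with split upper show ?thesis by (simp add: a_def)
qed

section \<open>Sparsity at most one, and the logarithmic inequality\<close>

text \<open>A nonzero degree-one coefficient would be the only nonzero coefficient, making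
  \<open>f\<close> a multiple of that coordinate. This settles the case in which the logarithm
  provides no positive lower bound.\<close>

lemma degree_one_sum_eq_0:
  assumes "sparsity n f \<le> 1" and nc: "\<not> coordinate_multiple n f"
  shows "(\<Sum>j=1..n. \<bar>fourier_coeff n f {j}\<bar>) = 0"
proof (rule ccontr)
  define A where "A = {S. S \<subseteq> {1..n} \<and> fourier_coeff n f S \<noteq> 0}"
  assume "(\<Sum>j=1..n. \<bar>fourier_coeff n f {j}\<bar>) \<noteq> 0"
  then have "\<not> (\<forall>j\<in>{1..n}. \<bar>fourier_coeff n f {j}\<bar> = 0)"
    using sum.neutral[of "{1..n}" "\<lambda>j. \<bar>fourier_coeff n f {j}\<bar>"] by blast
  then obtain j where j: "j \<in> {1..n}" "fourier_coeff n f {j} \<noteq> 0"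
    by auto
  have "finite A" "card A \<le> Suc 0"
    using assms(1) by (simp_all add: A_def sparsity_def)
  then have "S = T" if "S \<in> A" "T \<in> A" for S T
    using that card_le_Suc0_iff_eq by blast
  moreover have "{j} \<in> A" using j by (simp add: A_def)
  ultimately have zero: "fourier_coeff n f S = 0" if "S \<subseteq> {1..n}" "S \<noteq> {j}" for S
    using that unfolding A_def by blast
  have "f x = fourier_coeff n f {j} * x j" if "x \<in> cube n" for x
  proof -
    have "f x = (\<Sum>S\<in>Pow {1..n}. fourier_coeff n f S * chi S x)"
      using fourier_coeff_expansion[of n f] that by (simp add: is_fourier_expansion_def)
    also have "\<dots> = (\<Sum>S\<in>{{j}}. fourier_coeff n f S * chi S x)"
      using j zero by (intro sum.mono_neutral_right) auto
    finally show ?thesis by (simp add: chi_def)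
  qed
  then have "coordinate_multiple n f"
    unfolding coordinate_multiple_def by (intro bexI[OF _ j(1)] exI ballI)
  with nc show False by contradiction
qed

theorem mainTheorem2:
  shows "\<exists>c::real. c > 0 \<and>
    (\<forall>n::nat. \<forall>f::(nat \<Rightarrow> real) \<Rightarrow> real.
       n > 0 \<longrightarrow> f \<in> cube n \<rightarrow> {-1..1} \<longrightarrow> \<not> coordinate_multiple n f \<longrightarrow>
       ln (real (sparsity n f)) \<ge> c * (\<Sum>j=1..n. \<bar>fourier_coeff n f {j}\<bar>))"
\<comment> \<open>The sum is at most \<open>6 * d\<close>, and \<open>d * ln 2\<close> is at most
  twice the logarithm of the sparsity; \<open>12 = 6 * 2\<close>.\<close>
proof (intro exI[of _ "ln 2 / 12"] conjI allI impI)
  show "(0::real) < ln 2 / 12" by simp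
next
  fix n :: nat and f :: "(nat \<Rightarrow> real) \<Rightarrow> real"
  assume f: "f \<in> cube n \<rightarrow> {-1..1}" and nc: "\<not> coordinate_multiple n f"
  show "ln 2 / 12 * (\<Sum>j=1..n. \<bar>fourier_coeff n f {j}\<bar>) \<le> ln (real (sparsity n f))"
  proof (cases "sparsity n f \<le> 1")
    case True
    \<comment> \<open>Both logarithms are 0, the one at sparsity 0 by the convention
      \<open>ln 0 = 0\<close>.\<close>
    then have "sparsity n f = 0 \<or> sparsity n f = 1" by linarith
    then show ?thesis
      using degree_one_sum_eq_0[OF True nc] by auto
  next
    case False
    define s where "s = sparsity n f"
    \<comment> \<open>The base-2 logarithm of \<open>s\<close>, rounded up. Minimality gives
      \<open>2 ^ (d - 1) < s\<close>; combined with \<open>2 \<le> s\<close>, which absorbs the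
      rounding, it yields the factor 2.\<close>
    define d where "d = (LEAST d. s \<le> 2 ^ d)"
    have sd: "s \<le> 2 ^ d"
      unfolding d_def by (rule LeastI[of _ s]) (simp add: less_imp_le)
    have d: "d > 0" using sd False by (cases d) (auto simp: s_def)
    then have "\<not> s \<le> 2 ^ (d - 1)"
      using not_less_Least[of "d - 1" "\<lambda>d. s \<le> 2 ^ d"] by (simp add: d_def)
    then have "real (2 ^ (d - 1)) \<le> real s" by (simp only: of_nat_le_iff)
    then have "ln (2 ^ (d - 1)) \<le> ln (real s)" using False by (subst ln_le_cancel_iff) (simp_all add: s_def)
    then have "real (d - 1) * ln 2 \<le> ln (real s)" by (simp add: ln_realpow)
    moreover have "ln 2 \<le> ln (real s)" using False by (simp add: s_def)
    ultimately have "real d * ln 2 \<le> 2 * ln (real s)"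
      using d by (simp add: of_nat_diff algebra_simps)
    moreover have "ln 2 / 12 * (\<Sum>j=1..n. \<bar>fourier_coeff n f {j}\<bar>) \<le> ln 2 / 12 * (6 * real d)"
      using degree_one_sum_le[OF f d] sd by (intro mult_left_mono) (simp_all add: s_def)
    moreover have "ln 2 / 12 * (6 * real d) = real d * ln 2 / 2"
      by simp
    ultimately show ?thesis unfolding s_def by linarith
  qed
qed

end
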